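(* Let $k$ be a positive integer and let $f:\mathbb{Z}_{\ge 1}\to\mathbb{C}$ be a multiplicative function such that $f(p)=k$ for every prime $p$, and $f(p^{\alpha})=\alpha^{O(1)}$ for all primes $p$ and all integers $\alpha\ge 2$, with the constant implied by the $O$ uniform in $p$; that is, there is a constant $K>0$, independent of $p$ and $\alpha$, such that $|f(p^{\alpha})|\le \alpha^{K}$ for all primes $p$ and all integers $\alpha\ge 2$. Then, for real $x\ge 2$, $$ \sum_{n\le x} f(n)=C_{f}\, x(\log x)^{k-1}+O\big(x(\log x)^{k-2}\big), $$ where $$ C_{f}=\frac{1}{(k-1)!}\prod_{p}\left(\left(1-\frac{1}{p}\right)^{k}\sum_{\alpha\ge 0}\frac{f(p^{\alpha})}{p^{\alpha}}\right), $$ the product being over all primes $p$. The implied constant in the conclusion may depend on $f$ (and hence on $k$) but not on $x$.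
   Context: A function $f$ on the positive integers is multiplicative if $f(1)=1$ and $f(mn)=f(m)f(n)$ whenever $\gcd(m,n)=1$. Sums over $n\le x$ are over positive integers $n\le x$. *)

theory Defs
  imports "HOL-Analysis.Analysis" "HOL-Computational_Algebra.Computational_Algebra"
begin

(* Arithmetic functions are represented as functions on nat; their value at 0 is irrelevant. *)
definition multiplicative_fun :: "(nat \<Rightarrow> complex) \<Rightarrow> bool" where
  "multiplicative_fun f \<longleftrightarrow>
     f 1 = 1 \<and> (\<forall>m n. m \<ge> 1 \<longrightarrow> n \<ge> 1 \<longrightarrow> coprime m n \<longrightarrow> f (m * n) = f m * f n)"

definition local_series :: "(nat \<Rightarrow> complex) \<Rightarrow> nat \<Rightarrow> nat \<Rightarrow> complex" where
  "local_series f p \<alpha> = f (p ^ \<alpha>) / of_nat (p ^ \<alpha>)"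

(* Products over primes are rendered as infinite products over nat whose factors at
   non-primes are 1. The library's notion of convergent product allows finitely many
   zero factors, which can indeed occur here. *)
definition local_factor :: "nat \<Rightarrow> (nat \<Rightarrow> complex) \<Rightarrow> nat \<Rightarrow> complex" where
  "local_factor k f p =
     (if prime p then (1 - 1 / of_nat p) ^ k * (\<Sum>\<alpha>. local_series f p \<alpha>) else 1)"

definition mean_const :: "nat \<Rightarrow> (nat \<Rightarrow> complex) \<Rightarrow> complex" where
  "mean_const k f = 1 / fact (k - 1) * (\<Prod>p. local_factor k f p)"

end

theory Submission
  imports Defs "HOL-Real_Asymp.Real_Asymp"
begin

text \<open>
  Let \<open>g\<close> be the convolution of \<open>f\<close> with \<open>k\<close> copies of the Moebius function, so that \<open>f\<close> arises
  from \<open>g\<close> by summing over divisors \<open>k\<close> times. As \<open>f p = k\<close>, \<open>g\<close> vanishes at the primes; since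
  it grows only polynomially in the exponent at prime powers, \<open>\<Sum>\<bar>g n\<bar> / n\<^bsup>3/4\<^esup>\<close> converges by
  comparison with an Euler product, and \<open>C = \<Sum>g n / n\<close> is the product over primes occurring in
  \<open>C\<^sub>f\<close>. Summing over divisors once gives \<open>C x + O(x\<^bsup>3/4\<^esup>)\<close>. Each further
  divisor sum replaces the summatory function \<open>S x\<close> by \<open>\<Sum>n\<le>x. S (x / n)\<close>, which turns
  \<open>C x (ln x)\<^bsup>m\<^esup> / m!\<close> into \<open>C x (ln x)\<^bsup>m+1\<^esup> / (m+1)!\<close> by comparing the decreasing
  function \<open>(ln (x / t))\<^bsup>m\<^esup> / t\<close> with its integral, and gains one logarithm in the error term.
\<close>

subsection \<open>Divisor sums and their inverse\<close>

lemma multiplicative_fun_1: "multiplicative_fun f \<Longrightarrow> f (Suc 0) = 1"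
  by (simp add: multiplicative_fun_def)

lemma multiplicative_fun_mult:
  "multiplicative_fun f \<Longrightarrow> m > 0 \<Longrightarrow> n > 0 \<Longrightarrow> coprime m n \<Longrightarrow> f (m * n) = f m * f n"
  by (simp add: multiplicative_fun_def)

text \<open>Strong induction on \<open>n\<close>: splitting off the full power of a prime divisor
  leaves a strictly smaller coprime cofactor, so values at prime powers determine
  everything.\<close>

lemma multiplicative_fun_eqI:
  assumes f: "multiplicative_fun f" and g: "multiplicative_fun g"
    and eq: "\<And>p \<alpha>. prime p \<Longrightarrow> \<alpha> > 0 \<Longrightarrow> f (p ^ \<alpha>) = g (p ^ \<alpha>)"
    and "n > 0"
  shows "f n = g n"
  using \<open>n > 0\<close>
proof (induction n rule: less_induct)
  case (less n)
  show ?case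
  proof (cases "n = 1")
    case True
    then show ?thesis using f g by (simp add: multiplicative_fun_1)
  next
    case False
    then obtain p where p: "prime p" "p dvd n"
      using prime_factor_nat by blast
    have "multiplicity p n > 0"
      using p less.prems by (simp add: prime_multiplicity_gt_zero_iff)
    moreover have "\<exists>y. n = p ^ multiplicity p n * y \<and> \<not> p dvd y"
      using multiplicity_decompose'[of n p] less.prems p not_prime_unit by blast
    ultimately obtain \<alpha> y where y: "n = p ^ \<alpha> * y" "\<not> p dvd y" and a: "\<alpha> > 0"
      by blast
    have y0: "y > 0" using y(2) by (cases y) auto
    have pa: "p ^ \<alpha> > 1"
      using a prime_gt_1_nat[OF p(1)] by (metis one_less_power)
    have cop: "coprime (p ^ \<alpha>) y"
      using p y(2) by (simp add: prime_imp_coprime)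
    have "1 * y < p ^ \<alpha> * y" using pa y0 by (intro mult_strict_right_mono)
    then have "y < n" using y(1) by simp
    then have "f y = g y" using less.IH y0 by blast
    moreover have "f n = f (p ^ \<alpha>) * f y"
      unfolding y(1) using prime_gt_0_nat[OF p(1)] by (intro multiplicative_fun_mult[OF f _ y0 cop]) auto
    moreover have "g n = g (p ^ \<alpha>) * g y"
      unfolding y(1) using prime_gt_0_nat[OF p(1)] by (intro multiplicative_fun_mult[OF g _ y0 cop]) auto
    ultimately show ?thesis using eq[OF p(1) a] by simp
  qed
qed

text \<open>Dirichlet convolution with the constant function 1. At 0 the index set is infinite, so
  the sum takes the default value 0.\<close>

definition divisor_sum :: "(nat \<Rightarrow> 'a::comm_monoid_add) \<Rightarrow> nat \<Rightarrow> 'a" where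
  "divisor_sum f n = (\<Sum>d | d dvd n. f d)"

lemma divisor_sum_prime_power:
  assumes "prime (p::nat)"
  shows "divisor_sum f (p ^ \<alpha>) = (\<Sum>i\<le>\<alpha>. f (p ^ i))"
proof -
  have "{d. d dvd p ^ \<alpha>} = (\<lambda>i. p ^ i) ` {..\<alpha>}"
    using divides_primepow_nat[OF assms] by auto
  moreover have "inj_on (\<lambda>i. p ^ i) {..\<alpha>}"
    using prime_gt_1_nat[OF assms] by (auto simp: inj_on_def)
  ultimately show ?thesis
    by (simp add: divisor_sum_def sum.reindex)
qed

text \<open>For coprime \<open>m\<close> and \<open>n\<close>, every divisor of \<open>m * n\<close>
  is uniquely a divisor of \<open>m\<close> times a divisor of \<open>n\<close>, so the sum
  factors.\<close>

lemma multiplicative_divisor_sum: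
  assumes f: "multiplicative_fun f"
  shows "multiplicative_fun (divisor_sum f)"
  unfolding multiplicative_fun_def
proof (intro conjI allI impI)
  show "divisor_sum f 1 = 1"
    using f by (simp add: divisor_sum_def multiplicative_fun_1)
next
  fix m n :: nat
  assume m: "m \<ge> 1" and n: "n \<ge> 1" and mn: "coprime m n"
  have bij: "bij_betw (\<lambda>(a, b). a * b) ({d. d dvd m} \<times> {d. d dvd n}) {d. d dvd m * n}"
    unfolding bij_betw_def
  proof (intro conjI set_eqI)
    show "inj_on (\<lambda>(a, b). a * b) ({d. d dvd m} \<times> {d. d dvd n})"
    proof (rule inj_onI, clarsimp)
      fix a b c d assume ab: "a dvd m" "b dvd n" "c dvd m" "d dvd n" and eq: "a * b = c * d"
      \<comment> \<open>\<open>a\<close> divides \<open>c * d\<close> and is coprime to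
        \<open>d\<close>, hence divides \<open>c\<close>; by symmetry \<open>c\<close> divides
        \<open>a\<close>.\<close>
      have "coprime a d" "coprime c b"
        using ab mn by (meson coprime_divisors)+
      then have "a dvd c" "c dvd a"
        using eq by (metis coprime_dvd_mult_left_iff dvd_triv_left)+
      then have "a = c" by (simp add: dvd_antisym)
      moreover have "c \<noteq> 0" using ab m by auto
      ultimately show "a = c \<and> b = d" using eq by simp
    qed
  next
    fix d show "d \<in> (\<lambda>(a, b). a * b) ` ({d. d dvd m} \<times> {d. d dvd n}) \<longleftrightarrow> d \<in> {d. d dvd m * n}"
      by (auto intro: mult_dvd_mono elim!: dvd_productE)
  qed
  have "divisor_sum f (m * n) = (\<Sum>(a, b)\<in>{d. d dvd m} \<times> {d. d dvd n}. f (a * b))"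
    unfolding divisor_sum_def by (subst sum.reindex_bij_betw[OF bij, symmetric]) (simp add: case_prod_unfold)
  also have "\<dots> = (\<Sum>(a, b)\<in>{d. d dvd m} \<times> {d. d dvd n}. f a * f b)"
  proof (intro sum.cong refl, clarsimp)
    fix a b assume "a dvd m" "b dvd n"
    then show "f (a * b) = f a * f b"
      using m n mn by (intro multiplicative_fun_mult[OF f])
        (auto intro: coprime_divisors dest: dvd_pos_nat)
  qed
  also have "\<dots> = divisor_sum f m * divisor_sum f n"
    by (simp add: divisor_sum_def sum_product sum.cartesian_product)
  finally show "divisor_sum f (m * n) = divisor_sum f m * divisor_sum f n" .
qed

text \<open>
  For multiplicative \<open>f\<close> this is the Dirichlet convolution of \<open>f\<close> with the Moebius function.
\<close>
definition moebius_diff :: "(nat \<Rightarrow> complex) \<Rightarrow> nat \<Rightarrow> complex" where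
  "moebius_diff f n =
     (\<Prod>p\<in>prime_factors n. f (p ^ multiplicity p n) - f (p ^ (multiplicity p n - 1)))"

lemma multiplicative_moebius_diff: "multiplicative_fun (moebius_diff f)"
  unfolding multiplicative_fun_def
proof (intro conjI allI impI)
  show "moebius_diff f 1 = 1" by (simp add: moebius_diff_def)
next
  fix m n :: nat
  assume m: "m \<ge> 1" and n: "n \<ge> 1" and mn: "coprime m n"
  have disj: "prime_factors m \<inter> prime_factors n = {}"
    using mn by (metis coprime_common_divisor disjoint_iff in_prime_factors_iff not_prime_unit)
  have *: "multiplicity p (a * b) = multiplicity p a"
    if "p \<in> prime_factors a" "a \<ge> 1" "b \<ge> 1" "prime_factors a \<inter> prime_factors b = {}"
    for p a b :: nat
  proof -
    have "prime p" "\<not> p dvd b" using that by (auto simp: prime_factors_dvd)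
    then show ?thesis using that
      by (simp add: prime_elem_multiplicity_mult_distrib not_dvd_imp_multiplicity_0)
  qed
  have "moebius_diff f (m * n) =
      (\<Prod>p\<in>prime_factors m. f (p ^ multiplicity p (m*n)) - f (p ^ (multiplicity p (m*n) - 1))) *
      (\<Prod>p\<in>prime_factors n. f (p ^ multiplicity p (m*n)) - f (p ^ (multiplicity p (m*n) - 1)))"
    unfolding moebius_diff_def using m n disj
    by (subst prod.union_disjoint[symmetric]) (auto simp: prime_factors_product)
  moreover have "(\<Prod>p\<in>prime_factors m. f (p ^ multiplicity p (m*n)) - f (p ^ (multiplicity p (m*n) - 1)))
      = moebius_diff f m"
    unfolding moebius_diff_def using *[of _ m n] m n disj by (intro prod.cong) auto
  moreover have "(\<Prod>p\<in>prime_factors n. f (p ^ multiplicity p (m*n)) - f (p ^ (multiplicity p (m*n) - 1)))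
      = moebius_diff f n"
    unfolding moebius_diff_def using *[of _ n m] m n disj
    by (intro prod.cong) (auto simp: mult.commute Int_commute)
  ultimately show "moebius_diff f (m * n) = moebius_diff f m * moebius_diff f n" by simp
qed

text \<open>Restricted to positive exponents: at exponent 0 the defining product is empty and the
  value is 1, not a difference.\<close>

lemma moebius_diff_prime_power:
  assumes "prime p"
  shows "moebius_diff f (p ^ Suc \<alpha>) = f (p ^ Suc \<alpha>) - f (p ^ \<alpha>)"
proof -
  have "prime_factors (p ^ Suc \<alpha>) = {p}"
    using assms by (subst prime_factorization_prime_power) auto
  moreover have "multiplicity p (p ^ Suc \<alpha>) = Suc \<alpha>"
    using assms by (intro multiplicity_prime_power) auto
  ultimately show ?thesis by (simp add: moebius_diff_def del: power_Suc)
qed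

text \<open>Moebius inversion. Both sides are multiplicative, and at a prime power the sum of
  differences telescopes.\<close>

lemma divisor_sum_moebius_diff:
  assumes f: "multiplicative_fun f" and "n > 0"
  shows "divisor_sum (moebius_diff f) n = f n"
proof (rule multiplicative_fun_eqI[OF multiplicative_divisor_sum f])
  show "multiplicative_fun (moebius_diff f)" by (rule multiplicative_moebius_diff)
  fix p \<alpha> :: nat assume p: "prime p"
  show "divisor_sum (moebius_diff f) (p ^ \<alpha>) = f (p ^ \<alpha>)"
    unfolding divisor_sum_prime_power[OF p]
  proof (induction \<alpha>)
    case 0
    then show ?case
      using f multiplicative_moebius_diff[of f] by (simp add: multiplicative_fun_1)
  next
    case (Suc \<alpha>)
    then show ?case using moebius_diff_prime_power[OF p, of f \<alpha>] by simp
  qed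
qed fact

section \<open>Partial sums up to a real bound\<close>

lemma finite_nat_le_real: "finite {n. 1 \<le> n \<and> real n \<le> x}"
  by (rule finite_subset[of _ "{..nat \<lfloor>x\<rfloor>}"]) (auto simp: le_nat_floor)

text \<open>The bound is real so that \<open>x / real n\<close> can be inserted without
  rounding.\<close>

definition sum_upto :: "(nat \<Rightarrow> 'a::comm_monoid_add) \<Rightarrow> real \<Rightarrow> 'a" where
  "sum_upto f x = (\<Sum>n | 1 \<le> n \<and> real n \<le> x. f n)"

text \<open>Writing \<open>n = m * d\<close> turns the double sum into one over pairs with
  \<open>m * d \<le> x\<close>, grouped here by the complementary divisor \<open>m\<close>.\<close>

lemma sum_upto_divisor_sum:
  "sum_upto (divisor_sum f) x = sum_upto (\<lambda>n. sum_upto f (x / real n)) x"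
proof -
  let ?A = "\<lambda>x. {n. 1 \<le> n \<and> real n \<le> x}"
  have "sum_upto (divisor_sum f) x = (\<Sum>(n, d)\<in>(SIGMA n:?A x. {d. d dvd n}). f d)"
    unfolding sum_upto_def divisor_sum_def
    using finite_nat_le_real[of x] by (intro sum.Sigma) auto
  also have "\<dots> = (\<Sum>(m, d)\<in>(SIGMA m:?A x. ?A (x / real m)). f d)"
  proof (rule sum.reindex_bij_witness[of _ "\<lambda>(m, d). (m * d, d)" "\<lambda>(n, d). (n div d, d)"])
    fix z assume "z \<in> (SIGMA n:?A x. {d. d dvd n})"
    then obtain n d where z: "z = (n, d)" "1 \<le> n" "real n \<le> x" "d dvd n" by auto
    then obtain m where m: "n = m * d" by (metis dvd_def mult.commute)
    have "m \<le> n" using z m by auto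
    then have "real m \<le> x" using z by linarith
    then show "(case z of (n, d) \<Rightarrow> (n div d, d)) \<in> (SIGMA m:?A x. ?A (x / real m))"
      using z m by (auto simp: field_simps)
  next
    fix z assume "z \<in> (SIGMA m:?A x. ?A (x / real m))"
    then show "(case z of (m, d) \<Rightarrow> (m * d, d)) \<in> (SIGMA n:?A x. {d. d dvd n})"
      by (auto simp: field_simps)
  qed auto
  also have "\<dots> = sum_upto (\<lambda>n. sum_upto f (x / real n)) x"
    unfolding sum_upto_def using finite_nat_le_real by (intro sum.Sigma[symmetric]) auto
  finally show ?thesis .
qed

lemma sum_upto_cong: "(\<And>n. n > 0 \<Longrightarrow> f n = g n) \<Longrightarrow> sum_upto f x = sum_upto g x"
  unfolding sum_upto_def by (intro sum.cong) auto

subsection \<open>Euler products\<close>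

text \<open>Unique factorization with the exponent of one prime singled out; this drives the
  induction on the set of primes in the finite Euler product.\<close>

lemma bij_betw_prime_power_times:
  fixes p :: nat
  assumes p: "prime p" and P: "p \<notin> P"
  shows "bij_betw (\<lambda>(\<alpha>, m). p ^ \<alpha> * m) (UNIV \<times> {n. n > 0 \<and> prime_factors n \<subseteq> P})
           {n. n > 0 \<and> prime_factors n \<subseteq> insert p P}"
proof (rule bij_betwI[where g = "\<lambda>n. (multiplicity p n, n div p ^ multiplicity p n)"])
  show "(\<lambda>(\<alpha>, m). p ^ \<alpha> * m) \<in> UNIV \<times> {n. n > 0 \<and> prime_factors n \<subseteq> P} \<rightarrow>
      {n. n > 0 \<and> prime_factors n \<subseteq> insert p P}"
    using p by (auto simp: prime_factors_product prime_factorization_prime_power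
        prime_gt_0_nat split: if_splits)
next
  show "(\<lambda>n. (multiplicity p n, n div p ^ multiplicity p n)) \<in>
      {n. n > 0 \<and> prime_factors n \<subseteq> insert p P} \<rightarrow>
      UNIV \<times> {n. n > 0 \<and> prime_factors n \<subseteq> P}"
  proof (clarsimp, intro conjI)
    fix n :: nat assume n: "n > 0" and sub: "prime_factors n \<subseteq> insert p P"
    have dvd: "p ^ multiplicity p n dvd n" by (rule multiplicity_dvd)
    show "0 < n div p ^ multiplicity p n" using n p dvd by (simp add: div_greater_zero_iff dvd_imp_le prime_gt_0_nat)
    have nd: "\<not> p dvd n div p ^ multiplicity p n"
      using n p by (intro multiplicity_decompose) auto
    show "prime_factors (n div p ^ multiplicity p n) \<subseteq> P"
    proof
      fix q assume q: "q \<in> prime_factors (n div p ^ multiplicity p n)"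
      have "n div p ^ multiplicity p n dvd n" using dvd by (metis dvd_div_mult_self dvd_triv_left)
      then have "q \<in> prime_factors n" using q n dvd_prime_factors by blast
      moreover have "q \<noteq> p" using q nd by auto
      ultimately show "q \<in> P" using sub by auto
    qed
  qed
next
  fix z :: "nat \<times> nat"
  assume z: "z \<in> UNIV \<times> {n. n > 0 \<and> prime_factors n \<subseteq> P}"
  obtain \<alpha> m where z': "z = (\<alpha>, m)" by (cases z)
  have m: "m > 0" "prime_factors m \<subseteq> P" using z z' by auto
  have "\<not> p dvd m" using m p P by (auto simp: prime_factors_dvd)
  then have "multiplicity p (p ^ \<alpha> * m) = \<alpha>"
    using p by (intro multiplicity_decomposeI) auto
  then show "(case (case z of (\<alpha>, m) \<Rightarrow> p ^ \<alpha> * m) of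
      n \<Rightarrow> (multiplicity p n, n div p ^ multiplicity p n)) = z"
    using z' p by (simp add: prime_gt_0_nat)
qed (auto simp: multiplicity_dvd)

text \<open>Induction on \<open>P\<close>, expanding the product one prime at a time. Absolute
  summability is part of the claim because it justifies summing over exponent and cofactor
  jointly.\<close>

lemma finite_euler_product:
  fixes f :: "nat \<Rightarrow> complex"
  assumes f: "multiplicative_fun f" and "finite P" "\<And>p. p \<in> P \<Longrightarrow> prime p"
    and "\<And>p. p \<in> P \<Longrightarrow> summable (\<lambda>\<alpha>. norm (f (p ^ \<alpha>)))"
  shows "((\<lambda>n. norm (f n)) summable_on {n. n > 0 \<and> prime_factors n \<subseteq> P}) \<and>
    (f has_sum (\<Prod>p\<in>P. \<Sum>\<alpha>. f (p ^ \<alpha>))) {n. n > 0 \<and> prime_factors n \<subseteq> P}"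
  using assms(2-)
proof (induction P)
  case empty
  have "{n. n > 0 \<and> prime_factors n \<subseteq> {}} = {1::nat}"
    by (auto simp: prime_factorization_empty_iff)
  then show ?case using has_sum_finite[of "{1}" f] f by (simp add: multiplicative_fun_1)
next
  case (insert p P)
  let ?S = "{n. n > 0 \<and> prime_factors n \<subseteq> P}" and ?Q = "\<Prod>p\<in>P. \<Sum>\<alpha>. f (p ^ \<alpha>)"
  let ?F = "\<lambda>(\<alpha>, m). f (p ^ \<alpha>) * f m"
  have p: "prime p" and sm: "summable (\<lambda>\<alpha>. norm (f (p ^ \<alpha>)))" using insert.prems by auto
  have IH: "(\<lambda>n. norm (f n)) summable_on ?S" "(f has_sum ?Q) ?S" using insert by auto
  have F: "f (p ^ \<alpha> * m) = f (p ^ \<alpha>) * f m" if "m \<in> ?S" for \<alpha> m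
  proof (rule multiplicative_fun_mult[OF f])
    have "\<not> p dvd m" using that p insert.hyps by (auto simp: prime_factors_dvd)
    then show "coprime (p ^ \<alpha>) m" using p by (simp add: prime_imp_coprime)
  qed (use p that in \<open>auto simp: prime_gt_0_nat\<close>)
  have summ: "(\<lambda>z. norm (?F z)) summable_on (UNIV \<times> ?S)"
  proof (subst Infinite_Sum.abs_summable_on_Sigma_iff, intro conjI ballI)
    fix \<alpha> :: nat
    show "(\<lambda>m. norm (?F (\<alpha>, m))) summable_on ?S"
      using IH(1) by (auto simp: norm_mult intro: summable_on_cmult_right)
  next
    have "(\<lambda>\<alpha>. norm (f (p ^ \<alpha>)) * (\<Sum>\<^sub>\<infinity>m\<in>?S. norm (f m))) summable_on UNIV"
      using sm by (intro summable_on_cmult_left) (simp add: summable_on_UNIV_nonneg_real_iff)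
    moreover have "(\<Sum>\<^sub>\<infinity>m\<in>?S. norm (f (p ^ \<alpha>) * f m)) = norm (f (p ^ \<alpha>)) * (\<Sum>\<^sub>\<infinity>m\<in>?S. norm (f m))" for \<alpha>
      using IH(1) by (simp add: norm_mult infsum_cmult_right)
    ultimately show "(\<lambda>\<alpha>. norm (\<Sum>\<^sub>\<infinity>m\<in>?S. norm (?F (\<alpha>, m)))) summable_on UNIV"
      by (simp add: abs_mult infsum_nonneg)
  qed
  \<comment> \<open>Summing over the cofactor \<open>m\<close> first leaves the local series of
    \<open>p\<close> times the constant \<open>?Q\<close>.\<close>
  have hs: "(?F has_sum ((\<Sum>\<alpha>. f (p ^ \<alpha>)) * ?Q)) (UNIV \<times> ?S)"
  proof (rule has_sum_SigmaI)
    show "((\<lambda>m. ?F (\<alpha>, m)) has_sum f (p ^ \<alpha>) * ?Q) ?S" for \<alpha>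
      using has_sum_cmult_right[OF IH(2)] by simp
    have "(\<lambda>\<alpha>. f (p ^ \<alpha>)) sums (\<Sum>\<alpha>. f (p ^ \<alpha>))"
      by (rule summable_sums[OF summable_norm_cancel[OF sm]])
    from norm_summable_imp_has_sum[OF sm this]
    show "((\<lambda>\<alpha>. f (p ^ \<alpha>) * ?Q) has_sum (\<Sum>\<alpha>. f (p ^ \<alpha>)) * ?Q) UNIV"
      by (rule has_sum_cmult_left)
    show "?F summable_on UNIV \<times> ?S" by (rule Infinite_Sum.abs_summable_summable[OF summ])
  qed
  have bij: "bij_betw (\<lambda>(\<alpha>, m). p ^ \<alpha> * m) (UNIV \<times> ?S) {n. n > 0 \<and> prime_factors n \<subseteq> insert p P}"
    using bij_betw_prime_power_times[OF p] insert.hyps by blast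
  have "(\<lambda>n. norm (f n)) summable_on {n. n > 0 \<and> prime_factors n \<subseteq> insert p P}"
  proof -
    have "(\<lambda>z. norm (f (case z of (\<alpha>, m) \<Rightarrow> p ^ \<alpha> * m))) summable_on (UNIV \<times> ?S)"
      using summ by (rule summable_on_cong[THEN iffD1, rotated]) (auto simp: F)
    then show ?thesis by (subst (asm) summable_on_reindex_bij_betw[OF bij])
  qed
  moreover have "(f has_sum ((\<Sum>\<alpha>. f (p ^ \<alpha>)) * ?Q)) {n. n > 0 \<and> prime_factors n \<subseteq> insert p P}"
  proof -
    have "((\<lambda>z. f (case z of (\<alpha>, m) \<Rightarrow> p ^ \<alpha> * m)) has_sum ((\<Sum>\<alpha>. f (p ^ \<alpha>)) * ?Q)) (UNIV \<times> ?S)"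
      using hs by (rule has_sum_cong[THEN iffD1, rotated]) (auto simp: F)
    then show ?thesis by (subst (asm) has_sum_reindex_bij_betw[OF bij])
  qed
  ultimately show ?case using insert.hyps by simp
qed

text \<open>A finite set of positive integers involves only finitely many primes, so its sum is at
  most a finite Euler product. Each factor is at most \<open>1 + c p \<le> exp (c p)\<close>, which
  gives the uniform bound \<open>exp (suminf c)\<close>.\<close>

lemma multiplicative_abs_summable:
  fixes f :: "nat \<Rightarrow> complex"
  assumes f: "multiplicative_fun f"
    and sm: "\<And>p. prime p \<Longrightarrow> summable (\<lambda>\<alpha>. norm (f (p ^ \<alpha>)))"
    and le: "\<And>p. prime p \<Longrightarrow> (\<Sum>\<alpha>. norm (f (p ^ \<alpha>))) \<le> 1 + c p"
    and c: "summable c" "\<And>n. c n \<ge> 0"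
  shows "(\<lambda>n. norm (f n)) summable_on {0<..}"
proof (rule nonneg_bdd_above_summable_on)
  show "bdd_above (sum (\<lambda>n. norm (f n)) ` {F. F \<subseteq> {0<..} \<and> finite F})"
  proof (rule bdd_aboveI2)
    fix F :: "nat set" assume "F \<in> {F. F \<subseteq> {0<..} \<and> finite F}"
    then have F: "F \<subseteq> {0<..}" "finite F" by auto
    define P where "P = (\<Union>n\<in>F. prime_factors n)"
    have P: "finite P" "\<And>p. p \<in> P \<Longrightarrow> prime p" using F by (auto simp: P_def)
    \<comment> \<open>The finite Euler product is stated for complex functions, so the norms are
      embedded there and the result is pulled back to the reals.\<close>
    define h where "h = (\<lambda>n. complex_of_real (norm (f n)))"
    have h: "multiplicative_fun h"
      using f by (auto simp: multiplicative_fun_def h_def norm_mult)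
    have "(h has_sum (\<Prod>p\<in>P. \<Sum>\<alpha>. h (p ^ \<alpha>))) {n. n > 0 \<and> prime_factors n \<subseteq> P}"
      using finite_euler_product[OF h P] sm P by (simp add: h_def)
    also have "(\<Prod>p\<in>P. \<Sum>\<alpha>. h (p ^ \<alpha>)) = of_real (\<Prod>p\<in>P. \<Sum>\<alpha>. norm (f (p ^ \<alpha>)))"
      using sm P by (simp add: h_def suminf_of_real[symmetric])
    finally have hs: "((\<lambda>n. norm (f n)) has_sum (\<Prod>p\<in>P. \<Sum>\<alpha>. norm (f (p ^ \<alpha>))))
        {n. n > 0 \<and> prime_factors n \<subseteq> P}"
      unfolding h_def by (subst (asm) has_sum_of_real_iff)
    have "(\<Sum>n\<in>F. norm (f n)) \<le> (\<Prod>p\<in>P. \<Sum>\<alpha>. norm (f (p ^ \<alpha>)))"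
      using F by (intro finite_sum_le_has_sum[OF hs]) (auto simp: P_def)
    also have "\<dots> \<le> (\<Prod>p\<in>P. exp (c p))"
    proof (intro prod_mono conjI)
      fix p assume "p \<in> P"
      then show "0 \<le> (\<Sum>\<alpha>. norm (f (p ^ \<alpha>)))" using P sm by (intro suminf_nonneg) auto
      show "(\<Sum>\<alpha>. norm (f (p ^ \<alpha>))) \<le> exp (c p)"
        using le[OF P(2)[OF \<open>p \<in> P\<close>]] exp_ge_add_one_self[of "c p"] by linarith
    qed
    also have "\<dots> = exp (\<Sum>p\<in>P. c p)" using P by (simp add: exp_sum)
    also have "\<dots> \<le> exp (suminf c)" using c P by (simp add: sum_le_suminf)
    finally show "(\<Sum>n\<in>F. norm (f n)) \<le> exp (suminf c)" .
  qed
qed simp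

text \<open>The product over primes up to \<open>N\<close> sums \<open>f\<close> over all integers
  without larger prime factors. These include every \<open>n \<le> N\<close>, so the difference from
  the full sum is bounded by the tail of the absolutely convergent series.\<close>

lemma euler_product_LIMSEQ:
  fixes f :: "nat \<Rightarrow> complex"
  assumes f: "multiplicative_fun f" and sm: "(\<lambda>n. norm (f n)) summable_on {0<..}"
  shows "(\<lambda>N. \<Prod>p\<le>N. if prime p then \<Sum>\<alpha>. f (p ^ \<alpha>) else 1) \<longlonglongrightarrow> infsum f {0<..}"
proof -
  let ?G = "\<Sum>\<^sub>\<infinity>n\<in>{0<..}. norm (f n)"
  have smp: "summable (\<lambda>\<alpha>. norm (f (p ^ \<alpha>)))" if p: "prime p" for p
  proof -
    have "inj (\<lambda>\<alpha>. p ^ \<alpha>)" using prime_gt_1_nat[OF p] by (auto simp: inj_on_def)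
    moreover have "(\<lambda>n. norm (f n)) summable_on range (\<lambda>\<alpha>. p ^ \<alpha>)"
      using prime_gt_0_nat[OF p] by (intro summable_on_subset_banach[OF sm]) auto
    ultimately have "(\<lambda>\<alpha>. norm (f (p ^ \<alpha>))) summable_on UNIV"
      by (subst (asm) summable_on_reindex) (auto simp: o_def)
    then show ?thesis by (rule summable_on_imp_summable)
  qed
  have bound: "norm ((\<Prod>p\<le>N. if prime p then \<Sum>\<alpha>. f (p ^ \<alpha>) else 1) - infsum f {0<..})
      \<le> ?G - (\<Sum>n\<in>{0<..N}. norm (f n))" for N
  proof -
    let ?P = "{p. p \<le> N \<and> prime p}"
    let ?S = "{n. n > 0 \<and> prime_factors n \<subseteq> ?P}"
    have "(f has_sum (\<Prod>p\<in>?P. \<Sum>\<alpha>. f (p ^ \<alpha>))) ?S"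
      by (rule finite_euler_product[OF f, THEN conjunct2]) (auto intro: smp)
    moreover have "(f has_sum infsum f {0<..}) {0<..}"
      by (intro has_sum_infsum Infinite_Sum.abs_summable_summable[OF sm])
    ultimately have hs: "(f has_sum (infsum f {0<..} - (\<Prod>p\<in>?P. \<Sum>\<alpha>. f (p ^ \<alpha>)))) ({0<..} - ?S)"
      by (intro has_sum_Diff) auto
    have "(\<lambda>n. norm (f n)) summable_on ({0<..} - ?S)"
      by (intro summable_on_subset_banach[OF sm]) auto
    then have hs1: "((\<lambda>n. norm (f n)) has_sum (\<Sum>\<^sub>\<infinity>n\<in>{0<..} - ?S. norm (f n))) ({0<..} - ?S)"
      by simp
    have hs2: "((\<lambda>n. norm (f n)) has_sum (?G - (\<Sum>n\<in>{0<..N}. norm (f n)))) ({0<..} - {0<..N})"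
      using sm by (intro has_sum_Diff has_sum_finite has_sum_infsum) auto
    have "norm (infsum f {0<..} - (\<Prod>p\<in>?P. \<Sum>\<alpha>. f (p ^ \<alpha>))) \<le> (\<Sum>\<^sub>\<infinity>n\<in>{0<..} - ?S. norm (f n))"
      by (rule norm_has_sum_bound[OF hs1 hs])
    also have "\<dots> \<le> ?G - (\<Sum>n\<in>{0<..N}. norm (f n))"
    proof (rule has_sum_mono2[OF hs1 hs2])
      \<comment> \<open>An integer outside \<open>?S\<close> has a prime factor exceeding
        \<open>N\<close>, so it exceeds \<open>N\<close> itself.\<close>
      show "{0<..} - ?S \<subseteq> {0<..} - {0<..N}"
        by (auto simp: prime_factors_dvd) (meson dvd_imp_le le_trans)
    qed auto
    finally show ?thesis
      by (simp add: norm_minus_commute prod.inter_filter[symmetric] prod.If_cases Int_def)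
  qed
  \<comment> \<open>Extension by zero turns the unordered sum into an ordinary series, whose partial
    sums converge to \<open>?G\<close>.\<close>
  have "((\<lambda>n. if n \<in> {0<..} then norm (f n) else 0) has_sum ?G) UNIV"
    using sm by (subst has_sum_cong_neutral[where T = "{0<..}" and g = "\<lambda>n. norm (f n)"]) auto
  then have "(\<lambda>N. \<Sum>n\<le>N. if n \<in> {0<..} then norm (f n) else 0) \<longlonglongrightarrow> ?G"
    unfolding sums_def_le[symmetric] by (rule has_sum_imp_sums)
  moreover have "(\<Sum>n\<le>N. if n \<in> {0<..} then norm (f n) else 0) = (\<Sum>n\<in>{0<..N}. norm (f n))" for N
    by (rule sum.mono_neutral_cong_right) auto
  ultimately have "(\<lambda>N. \<Sum>n\<in>{0<..N}. norm (f n)) \<longlonglongrightarrow> ?G" by simp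
  then have "(\<lambda>N. ?G - (\<Sum>n\<in>{0<..N}. norm (f n))) \<longlonglongrightarrow> 0"
    using tendsto_diff[OF tendsto_const[of ?G]] by fastforce
  then have "(\<lambda>N. (\<Prod>p\<le>N. if prime p then \<Sum>\<alpha>. f (p ^ \<alpha>) else 1) - infsum f {0<..}) \<longlonglongrightarrow> 0"
    by (rule Lim_null_comparison[rotated]) (use bound in \<open>auto intro: always_eventually\<close>)
  then show ?thesis by (simp add: LIM_zero_iff)
qed

subsection \<open>Summatory functions\<close>

lemma le_nat_floor_iff:
  assumes "1 \<le> n"
  shows "real n \<le> x \<longleftrightarrow> n \<le> nat \<lfloor>x\<rfloor>"
proof -
  have "n \<le> nat \<lfloor>x\<rfloor> \<longleftrightarrow> int n \<le> \<lfloor>x\<rfloor>" using assms by linarith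
  then show ?thesis by (simp add: le_floor_iff)
qed

lemma sum_upto_eq: "sum_upto f x = (\<Sum>n=1..nat \<lfloor>x\<rfloor>. f n)"
proof -
  have "real n \<le> x \<longleftrightarrow> n \<le> nat \<lfloor>x\<rfloor>" if "1 \<le> n" for n
    by (rule le_nat_floor_iff[OF that])
  then show ?thesis unfolding sum_upto_def by (intro sum.cong) auto
qed

text \<open>The integral test, with differences of an antiderivative \<open>F\<close> in place of
  integrals. It is applied on unit intervals and on the last, possibly shorter, interval ending at
  \<open>x\<close>.\<close>

lemma sum_upto_antiderivative_bounds:
  fixes \<phi> F :: "real \<Rightarrow> real"
  assumes x: "x \<ge> 1"
    and F: "\<And>t. 1 \<le> t \<Longrightarrow> t \<le> x \<Longrightarrow> (F has_real_derivative \<phi> t) (at t)"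
    and anti: "\<And>s t. 1 \<le> s \<Longrightarrow> s \<le> t \<Longrightarrow> t \<le> x \<Longrightarrow> \<phi> t \<le> \<phi> s"
    and nonneg: "\<And>t. 1 \<le> t \<Longrightarrow> t \<le> x \<Longrightarrow> 0 \<le> \<phi> t"
  shows "F x - F 1 \<le> sum_upto (\<lambda>n. \<phi> (real n)) x"
    and "sum_upto (\<lambda>n. \<phi> (real n)) x \<le> \<phi> 1 + (F x - F 1)"
proof -
  \<comment> \<open>By the mean value theorem the increment of \<open>F\<close> is
    \<open>(t - s) * \<phi> z\<close> for some \<open>z\<close> between \<open>s\<close> and
    \<open>t\<close>, and \<open>\<phi>\<close> is decreasing.\<close>
  have bnd: "(t - s) * \<phi> t \<le> F t - F s \<and> F t - F s \<le> (t - s) * \<phi> s"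
    if "1 \<le> s" "s \<le> t" "t \<le> x" for s t
  proof (cases "s = t")
    case False
    have "\<exists>z>s. z < t \<and> F t - F s = (t - s) * \<phi> z"
      by (rule MVT2) (use False that F in auto)
    then obtain z where z: "s < z" "z < t" "F t - F s = (t - s) * \<phi> z" by blast
    have "\<phi> t \<le> \<phi> z" "\<phi> z \<le> \<phi> s" using anti[of z t] anti[of s z] z that by auto
    then show ?thesis using z(3) that by (auto intro: mult_left_mono)
  qed simp
  \<comment> \<open>The extra \<open>\<phi> (real N)\<close> in the lower bound pays for the final
    piece from \<open>N\<close> to \<open>x\<close>.\<close>
  have ind: "F (real N) - F 1 + \<phi> (real N) \<le> (\<Sum>n=1..N. \<phi> (real n)) \<and>
      (\<Sum>n=1..N. \<phi> (real n)) \<le> \<phi> 1 + (F (real N) - F 1)" if "N \<ge> 1" "real N \<le> x" for N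
    using that
  proof (induction N rule: nat_induct_at_least)
    case (Suc N)
    then show ?case using bnd[of "real N" "real (Suc N)"] by simp
  qed simp
  define N where "N = nat \<lfloor>x\<rfloor>"
  have N: "N \<ge> 1" "real N \<le> x" "x - real N \<le> 1" using x by (auto simp: N_def le_nat_iff le_floor_iff) linarith+
  have "0 \<le> \<phi> (real N)" "0 \<le> \<phi> x" using N x nonneg by auto
  then have "0 \<le> (x - real N) * \<phi> x" "(x - real N) * \<phi> (real N) \<le> \<phi> (real N)"
    using N mult_right_mono[of "x - real N" 1 "\<phi> (real N)"] by auto
  then have "0 \<le> F x - F (real N)" "F x - F (real N) \<le> \<phi> (real N)"
    using bnd[of "real N" x] N by auto
  then show "F x - F 1 \<le> sum_upto (\<lambda>n. \<phi> (real n)) x"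
    "sum_upto (\<lambda>n. \<phi> (real n)) x \<le> \<phi> 1 + (F x - F 1)"
    using ind[OF N(1,2)] unfolding sum_upto_eq N_def[symmetric] by linarith+
qed

text \<open>The antiderivative \<open>?F\<close> vanishes at \<open>x\<close>, so its increment from
  1 is exactly the main term; the error is the first term
  \<open>?\<phi> 1 = ln x ^ m\<close>.\<close>

lemma sum_upto_ln_power:
  fixes x :: real
  assumes x: "x \<ge> 1"
  shows "\<bar>sum_upto (\<lambda>n. ln (x / real n) ^ m / real n) x - ln x ^ Suc m / real (Suc m)\<bar> \<le> ln x ^ m"
proof -
  let ?\<phi> = "\<lambda>t. (ln x - ln t) ^ m / t" and ?F = "\<lambda>t. - ((ln x - ln t) ^ Suc m / real (Suc m))"
  have F: "(?F has_real_derivative ?\<phi> t) (at t)" if "1 \<le> t" for t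
    using that by (auto intro!: derivative_eq_intros simp del: power_Suc of_nat_Suc simp: field_simps)
  have anti: "?\<phi> t \<le> ?\<phi> s" if "1 \<le> s" "s \<le> t" "t \<le> x" for s t
    using that by (intro frac_le power_mono zero_le_power) auto
  have nonneg: "0 \<le> ?\<phi> t" if "1 \<le> t" "t \<le> x" for t
    using that by auto
  have eq: "sum_upto (\<lambda>n. ln (x / real n) ^ m / real n) x = sum_upto (\<lambda>n. ?\<phi> (real n)) x"
    using x by (intro sum_upto_cong) (simp add: ln_div)
  show ?thesis
    using sum_upto_antiderivative_bounds[of x ?F ?\<phi>, OF x F anti nonneg] x
    unfolding eq by (auto simp del: power_Suc of_nat_Suc)
qed

text \<open>A power-saving error term, summed over \<open>x / n\<close>, costs only
  \<open>O(x)\<close> and no logarithm. The 4 comes from the antiderivative of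
  \<open>t powr (-3/4)\<close>.\<close>

lemma sum_upto_powr_le:
  assumes x: "x \<ge> 1"
  shows "sum_upto (\<lambda>n. (x / real n) powr (3/4)) x \<le> 4 * x"
proof -
  let ?\<phi> = "\<lambda>t. t powr (-3/4) :: real" and ?F = "\<lambda>t. 4 * t powr (1/4) :: real"
  have F: "(?F has_real_derivative ?\<phi> t) (at t)" if "1 \<le> t" for t
    using that by (auto intro!: derivative_eq_intros)
  have anti: "?\<phi> t \<le> ?\<phi> s" if "1 \<le> s" "s \<le> t" "t \<le> x" for s t
    using that by (intro powr_mono2') auto
  have "sum_upto (\<lambda>n. ?\<phi> (real n)) x \<le> 4 * x powr (1/4)"
    using sum_upto_antiderivative_bounds(2)[of x ?F ?\<phi>, OF x F anti] by simp
  then have "x powr (3/4) * sum_upto (\<lambda>n. ?\<phi> (real n)) x \<le> x powr (3/4) * (4 * x powr (1/4))"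
    by (intro mult_left_mono) auto
  also have "\<dots> = 4 * x" using x by (simp add: powr_add[symmetric])
  finally show ?thesis
    using x by (simp add: sum_upto_def sum_distrib_left powr_divide powr_minus_divide)
qed

text \<open>Exchanging summation, \<open>f d\<close> is counted once for each multiple of
  \<open>d\<close> up to \<open>x\<close>.\<close>

lemma sum_upto_divisor_sum_floor:
  fixes f :: "nat \<Rightarrow> 'a::comm_semiring_1"
  shows "sum_upto (divisor_sum f) x = sum_upto (\<lambda>d. of_nat (nat \<lfloor>x / real d\<rfloor>) * f d) x"
proof -
  let ?A = "{n. 1 \<le> n \<and> real n \<le> x}"
  have "sum_upto (divisor_sum f) x = (\<Sum>m\<in>?A. \<Sum>d\<in>{d \<in> ?A. real d * real m \<le> x}. f d)"
    unfolding sum_upto_divisor_sum unfolding sum_upto_def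
  proof (intro sum.cong refl set_eqI)
    fix m d assume "m \<in> ?A"
    then have "1 \<le> m" by simp
    then have le: "real d \<le> real d * real m" using mult_left_mono[of 1 "real m" "real d"] by simp
    have "real d \<le> x / real m \<longleftrightarrow> real d * real m \<le> x"
      using \<open>1 \<le> m\<close> by (simp add: pos_le_divide_eq)
    then show "d \<in> {n. 1 \<le> n \<and> real n \<le> x / real m} \<longleftrightarrow> d \<in> {d \<in> ?A. real d * real m \<le> x}"
      by (auto intro: order_trans[OF le])
  qed
  also have "\<dots> = (\<Sum>d\<in>?A. \<Sum>m\<in>{m \<in> ?A. real d * real m \<le> x}. f d)"
    by (rule sum.swap_restrict) (rule finite_nat_le_real)+
  also have "\<dots> = sum_upto (\<lambda>d. of_nat (nat \<lfloor>x / real d\<rfloor>) * f d) x"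
    unfolding sum_upto_def
  proof (rule sum.cong[OF refl])
    fix d assume "d \<in> ?A"
    then have d: "1 \<le> d" by simp
    have "{m \<in> ?A. real d * real m \<le> x} = {1..nat \<lfloor>x / real d\<rfloor>}"
    proof (intro set_eqI)
      fix m
      have le: "real m \<le> real d * real m" using d mult_right_mono[of 1 "real d" "real m"] by simp
      have "real m \<le> x / real d \<longleftrightarrow> real d * real m \<le> x"
        using d by (simp add: pos_le_divide_eq mult.commute)
      then show "m \<in> {m \<in> ?A. real d * real m \<le> x} \<longleftrightarrow> m \<in> {1..nat \<lfloor>x / real d\<rfloor>}"
        using le_nat_floor_iff[of m "x / real d"] by (auto intro: order_trans[OF le])
    qed
    then show "(\<Sum>m\<in>{m \<in> ?A. real d * real m \<le> x}. f d) = of_nat (nat \<lfloor>x / real d\<rfloor>) * f d"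
      by simp
  qed
  finally show ?thesis .
qed

text \<open>For \<open>y \<ge> 1\<close> the error is at most 1; for \<open>y < 1\<close> the floor
  is 0 and \<open>y \<le> y powr (3/4)\<close>. Validity for all positive \<open>y\<close> lets
  divisors \<open>d > x\<close> be treated like the others.\<close>

lemma floor_diff_le_powr:
  fixes y :: real
  assumes "y > 0"
  shows "\<bar>real (nat \<lfloor>y\<rfloor>) - y\<bar> \<le> y powr (3/4)"
proof (cases "y < 1")
  case True
  then have "y powr 1 \<le> y powr (3/4)" using assms by (intro powr_mono') auto
  moreover have "\<lfloor>y\<rfloor> = 0" using True assms by (simp add: floor_eq_iff)
  ultimately show ?thesis using assms by simp
next
  case False
  then have "1 \<le> y powr (3/4)" by (intro ge_one_powr_ge_zero) auto
  moreover have "\<bar>real (nat \<lfloor>y\<rfloor>) - y\<bar> \<le> 1" using False by linarith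
  ultimately show ?thesis by linarith
qed

text \<open>Both the floor sum and \<open>x\<close> times the sum of \<open>g d / d\<close> are
  taken over all positive \<open>d\<close> and compared term by term, so truncating the series needs
  no separate estimate.\<close>

lemma sum_upto_divisor_sum_linear:
  fixes g :: "nat \<Rightarrow> complex"
  assumes sm: "(\<lambda>n. norm (g n) * real n powr (-3/4)) summable_on {0<..}"
  shows "\<exists>M\<ge>0. \<forall>x\<ge>1. norm (sum_upto (divisor_sum g) x - (\<Sum>\<^sub>\<infinity>n\<in>{0<..}. g n / of_nat n) * of_real x)
           \<le> M * x powr (3/4)"
proof (intro exI[of _ "\<Sum>\<^sub>\<infinity>n\<in>{0<..}. norm (g n) * real n powr (-3/4)"] conjI allI impI)
  let ?G = "\<Sum>\<^sub>\<infinity>n\<in>{0<..}. norm (g n) * real n powr (-3/4)"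
  let ?C = "\<Sum>\<^sub>\<infinity>n\<in>{0<..}. g n / of_nat n"
  show "?G \<ge> 0" by (intro infsum_nonneg) auto
  fix x :: real assume x: "x \<ge> 1"
  have "(\<lambda>n. norm (g n / of_nat n)) summable_on {0<..}"
  proof (rule Infinite_Sum.abs_summable_on_comparison_test'[OF sm])
    fix n :: nat assume "n \<in> {0<..}"
    then have "real n powr (-1) \<le> real n powr (-3/4)" by (intro powr_mono) auto
    then have "norm (g n) * real n powr (-1) \<le> norm (g n) * real n powr (-3/4)"
      by (intro mult_left_mono) auto
    moreover have "norm (g n / of_nat n) = norm (g n) * real n powr (-1)"
      using \<open>n \<in> {0<..}\<close> by (simp add: norm_divide powr_neg_one)
    ultimately show "norm (g n / of_nat n) \<le> norm (g n) * real n powr (-3/4)" by simp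
  qed
  then have "((\<lambda>n. g n / of_nat n) has_sum ?C) {0<..}"
    by (rule has_sum_infsum[OF Infinite_Sum.abs_summable_summable])
  then have 1: "((\<lambda>n. (g n / of_nat n) * of_real x) has_sum (?C * of_real x)) {0<..}"
    by (rule has_sum_cmult_left)
  have "((\<lambda>d. of_nat (nat \<lfloor>x / real d\<rfloor>) * g d) has_sum sum_upto (divisor_sum g) x) {n. 1 \<le> n \<and> real n \<le> x}"
    unfolding sum_upto_divisor_sum_floor unfolding sum_upto_def
    by (intro has_sum_finite finite_nat_le_real)
  \<comment> \<open>For \<open>d > x\<close> the floor is 0, so extending the range changes
    nothing.\<close>
  then have 2: "((\<lambda>d. of_nat (nat \<lfloor>x / real d\<rfloor>) * g d) has_sum sum_upto (divisor_sum g) x) {0<..}"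
  proof (rule has_sum_cong_neutral[THEN iffD1, rotated -1])
    fix d assume "d \<in> {0<..} - {n. 1 \<le> n \<and> real n \<le> x}"
    then have "\<lfloor>x / real d\<rfloor> = 0" using x by (auto simp: floor_eq_iff)
    then show "of_nat (nat \<lfloor>x / real d\<rfloor>) * g d = 0" by simp
  qed auto
  have 3: "((\<lambda>d. of_nat (nat \<lfloor>x / real d\<rfloor>) * g d - (g d / of_nat d) * of_real x) has_sum
      (sum_upto (divisor_sum g) x - ?C * of_real x)) {0<..}"
    using has_sum_add[OF 2 has_sum_uminusI[OF 1]] by simp
  have 4: "((\<lambda>n. x powr (3/4) * (norm (g n) * real n powr (-3/4))) has_sum (x powr (3/4) * ?G)) {0<..}"
    using sm by (intro has_sum_cmult_right has_sum_infsum)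
  have "norm (sum_upto (divisor_sum g) x - ?C * of_real x) \<le> x powr (3/4) * ?G"
  proof (rule norm_infsum_le[OF 3 4])
    fix d :: nat assume "d \<in> {0<..}"
    then have d: "d > 0" by simp
    have "of_nat (nat \<lfloor>x / real d\<rfloor>) * g d - (g d / of_nat d) * of_real x =
        of_real (real (nat \<lfloor>x / real d\<rfloor>) - x / real d) * g d"
      by (simp add: algebra_simps)
    then have "norm (of_nat (nat \<lfloor>x / real d\<rfloor>) * g d - (g d / of_nat d) * of_real x) =
        \<bar>real (nat \<lfloor>x / real d\<rfloor>) - x / real d\<bar> * norm (g d)"
      by (simp only: norm_mult norm_of_real)
    also have "\<dots> \<le> (x / real d) powr (3/4) * norm (g d)"
      using x d by (intro mult_right_mono floor_diff_le_powr) auto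
    also have "\<dots> = x powr (3/4) * (norm (g d) * real d powr (-3/4))"
      using x by (simp add: powr_divide powr_minus_divide)
    finally show "norm (of_nat (nat \<lfloor>x / real d\<rfloor>) * g d - (g d / of_nat d) * of_real x) \<le>
      x powr (3/4) * (norm (g d) * real d powr (-3/4))" .
  qed
  then show "norm (sum_upto (divisor_sum g) x - ?C * of_real x) \<le> ?G * x powr (3/4)"
    by (simp add: mult.commute)
qed

text \<open>The hypothesis is inserted at every \<open>x / n\<close>. The first error comes from
  comparing the resulting logarithmic sum with its integral, the second collects the given errors
  \<open>E (x / n)\<close>.\<close>

lemma sum_upto_divisor_sum_step:
  fixes f :: "nat \<Rightarrow> complex"
  assumes f: "\<And>x. x \<ge> 1 \<Longrightarrow> norm (sum_upto f x - C * of_real (x * ln x ^ m / fact m)) \<le> E x"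
    and x: "x \<ge> 1"
  shows "norm (sum_upto (divisor_sum f) x - C * of_real (x * ln x ^ Suc m / fact (Suc m)))
    \<le> norm C * (x * ln x ^ m) + sum_upto (\<lambda>n. E (x / real n)) x"
proof -
  let ?L = "sum_upto (\<lambda>n. ln (x / real n) ^ m / real n) x"
  let ?D = "sum_upto (\<lambda>n. sum_upto f (x / real n) - C * of_real (x / real n * ln (x / real n) ^ m / fact m)) x"
  have main: "sum_upto (\<lambda>n. C * of_real (x / real n * ln (x / real n) ^ m / fact m)) x = C * of_real (x * ?L / fact m)"
    by (simp add: sum_upto_def sum_distrib_left sum_divide_distrib)
  have ring_eq: "s - b = c + d" if "s = d + a" "a - b = c" for s a b c d :: complex
    using that by simp
  have "sum_upto (divisor_sum f) x = ?D + C * of_real (x * ?L / fact m)"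
    unfolding main[symmetric] sum_upto_divisor_sum by (simp add: sum_upto_def sum.distrib[symmetric])
  \<comment> \<open>As \<open>(m + 1)! = (m + 1) * m!\<close>, the two main terms differ exactly by
    the error of the integral comparison for \<open>?L\<close>.\<close>
  moreover have "x * ?L / fact m - x * ln x ^ Suc m / fact (Suc m) =
      x / fact m * (?L - ln x ^ Suc m / real (Suc m))"
    unfolding fact_Suc by (simp add: right_diff_distrib del: power_Suc of_nat_Suc)
  then have "C * of_real (x * ?L / fact m) - C * of_real (x * ln x ^ Suc m / fact (Suc m)) =
      C * of_real (x / fact m * (?L - ln x ^ Suc m / real (Suc m)))"
    by (simp only: of_real_diff[symmetric] right_diff_distrib[symmetric])
  ultimately have eq: "sum_upto (divisor_sum f) x - C * of_real (x * ln x ^ Suc m / fact (Suc m)) =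
      C * of_real (x / fact m * (?L - ln x ^ Suc m / real (Suc m))) + ?D"
    by (rule ring_eq)
  have tri: "norm (sum_upto (divisor_sum f) x - C * of_real (x * ln x ^ Suc m / fact (Suc m)))
      \<le> norm (C * of_real (x / fact m * (?L - ln x ^ Suc m / real (Suc m)))) + norm ?D"
    unfolding eq by (rule norm_triangle_ineq)
  have D: "norm ?D \<le> sum_upto (\<lambda>n. E (x / real n)) x"
    unfolding sum_upto_def[of _ x]
  proof (rule sum_norm_le)
    fix n assume "n \<in> {n. 1 \<le> n \<and> real n \<le> x}"
    then have "1 \<le> x / real n" by (simp add: pos_le_divide_eq)
    then show "norm (sum_upto f (x / real n) - C * of_real (x / real n * ln (x / real n) ^ m / fact m))
        \<le> E (x / real n)"
      by (rule f)
  qed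
  have "norm (C * of_real (x / fact m * (?L - ln x ^ Suc m / real (Suc m)))) =
      norm C * (x / fact m * \<bar>?L - ln x ^ Suc m / real (Suc m)\<bar>)"
    unfolding norm_mult norm_of_real abs_mult using x by simp
  also have "\<dots> \<le> norm C * (x / 1 * ln x ^ m)"
    using x by (intro mult_left_mono mult_mono frac_le sum_upto_ln_power) (auto simp: fact_ge_1)
  finally have "norm (C * of_real (x / fact m * (?L - ln x ^ Suc m / real (Suc m)))) \<le> norm C * (x * ln x ^ m)"
    by simp
  with tri D show ?thesis by linarith
qed

subsection \<open>Iterated divisor sums\<close>

lemma multiplicative_moebius_diff_power:
  "multiplicative_fun f \<Longrightarrow> multiplicative_fun ((moebius_diff ^^ j) f)"
  by (induction j) (simp_all add: multiplicative_moebius_diff)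

lemma sum_upto_moebius_diff:
  "multiplicative_fun f \<Longrightarrow> sum_upto f x = sum_upto (divisor_sum (moebius_diff f)) x"
  by (intro sum_upto_cong) (simp add: divisor_sum_moebius_diff)

text \<open>Here \<open>m\<close> is \<open>k - 2\<close>, so the exponent in the error is a natural
  number; \<open>k = 1\<close> is treated separately. The bound uses \<open>1 + ln x\<close> because
  it must hold down to \<open>x = 1\<close>, a value that \<open>x / n\<close> can reach and where
  \<open>ln x\<close> vanishes.\<close>

lemma sum_upto_asymptotics:
  fixes f :: "nat \<Rightarrow> complex"
  assumes "multiplicative_fun f"
    and "(\<lambda>n. norm ((moebius_diff ^^ Suc (Suc m)) f n) * real n powr (-3/4)) summable_on {0<..}"
  shows "\<exists>M\<ge>0. \<forall>x\<ge>1. norm (sum_upto f x -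
      (\<Sum>\<^sub>\<infinity>n\<in>{0<..}. (moebius_diff ^^ Suc (Suc m)) f n / of_nat n) * of_real (x * ln x ^ Suc m / fact (Suc m)))
      \<le> M * (x * (1 + ln x) ^ m)"
  using assms
proof (induction m arbitrary: f)
  case (0 f)
  let ?h = "moebius_diff f" and ?g = "moebius_diff (moebius_diff f)"
  let ?C = "\<Sum>\<^sub>\<infinity>n\<in>{0<..}. ?g n / of_nat n"
  \<comment> \<open>The first divisor sum, from \<open>?g\<close> to \<open>?h\<close>, gives a
    linear main term; the second, from \<open>?h\<close> to \<open>f\<close>, creates the first
    logarithm.\<close>
  obtain M where M: "M \<ge> 0"
    and le: "\<And>x. x \<ge> 1 \<Longrightarrow> norm (sum_upto ?h x - ?C * of_real x) \<le> M * x powr (3/4)"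
    using sum_upto_divisor_sum_linear[of ?g] 0(2) sum_upto_moebius_diff[OF multiplicative_moebius_diff, of f]
    by auto
  show ?case
  proof (intro exI[of _ "norm ?C + M * 4"] conjI allI impI)
    show "norm ?C + M * 4 \<ge> 0" using M by simp
    fix x :: real assume x: "x \<ge> 1"
    have "norm (sum_upto f x - ?C * of_real (x * ln x ^ Suc 0 / fact (Suc 0)))
        \<le> norm ?C * (x * ln x ^ 0) + sum_upto (\<lambda>n. M * (x / real n) powr (3/4)) x"
      unfolding sum_upto_moebius_diff[OF 0(1)]
      by (rule sum_upto_divisor_sum_step[OF _ x]) (use le in simp)
    also have "sum_upto (\<lambda>n. M * (x / real n) powr (3/4)) x = M * sum_upto (\<lambda>n. (x / real n) powr (3/4)) x"
      by (simp add: sum_upto_def sum_distrib_left)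
    also have "\<dots> \<le> M * (4 * x)"
      using M sum_upto_powr_le[OF x] by (rule mult_left_mono[rotated])
    finally show "norm (sum_upto f x - (\<Sum>\<^sub>\<infinity>n\<in>{0<..}. (moebius_diff ^^ Suc (Suc 0)) f n / of_nat n) *
        of_real (x * ln x ^ Suc 0 / fact (Suc 0))) \<le> (norm ?C + M * 4) * (x * (1 + ln x) ^ 0)"
      by (simp add: algebra_simps)
  qed
next
  case (Suc m f)
  let ?h = "moebius_diff f"
  let ?C = "\<Sum>\<^sub>\<infinity>n\<in>{0<..}. (moebius_diff ^^ Suc (Suc (Suc m))) f n / of_nat n"
  \<comment> \<open>Moving one application inside lets the induction hypothesis for
    \<open>?h\<close> speak of the same constant \<open>?C\<close>.\<close>
  have shift: "(moebius_diff ^^ Suc (Suc (Suc m))) f = (moebius_diff ^^ Suc (Suc m)) ?h"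
    by (simp only: funpow_Suc_right o_apply)
  obtain M where M: "M \<ge> 0"
    and le: "\<And>x. x \<ge> 1 \<Longrightarrow> norm (sum_upto ?h x - ?C * of_real (x * ln x ^ Suc m / fact (Suc m)))
      \<le> M * (x * (1 + ln x) ^ m)"
    using Suc.IH[OF multiplicative_moebius_diff Suc.prems(2)[unfolded shift]] unfolding shift by blast
  show ?case
  proof (intro exI[of _ "norm ?C + M"] conjI allI impI)
    show "norm ?C + M \<ge> 0" using M by simp
    fix x :: real assume x: "x \<ge> 1"
    have harmonic: "sum_upto (\<lambda>n. 1 / real n) x \<le> 1 + ln x"
      using sum_upto_ln_power[OF x, of 0] by simp
    have "norm (sum_upto f x - ?C * of_real (x * ln x ^ Suc (Suc m) / fact (Suc (Suc m))))
        \<le> norm ?C * (x * ln x ^ Suc m) +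
          sum_upto (\<lambda>n. M * (x / real n * (1 + ln (x / real n)) ^ m)) x"
      unfolding sum_upto_moebius_diff[OF Suc.prems(1)]
      by (rule sum_upto_divisor_sum_step[OF le x])
    also have "\<dots> \<le> norm ?C * (x * (1 + ln x) ^ Suc m) + M * (x * (1 + ln x) ^ Suc m)"
    proof (rule add_mono)
      show "norm ?C * (x * ln x ^ Suc m) \<le> norm ?C * (x * (1 + ln x) ^ Suc m)"
        using x by (intro mult_left_mono power_mono) auto
      \<comment> \<open>Bounding \<open>ln (x / n)\<close> by \<open>ln x\<close> leaves a harmonic
        sum, which supplies the one additional factor \<open>1 + ln x\<close>.\<close>
      have "sum_upto (\<lambda>n. M * (x / real n * (1 + ln (x / real n)) ^ m)) x
          \<le> sum_upto (\<lambda>n. M * (x / real n * (1 + ln x) ^ m)) x"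
        unfolding sum_upto_def
      proof (rule sum_mono)
        fix n assume "n \<in> {n. 1 \<le> n \<and> real n \<le> x}"
        then have n: "1 \<le> real n" "1 \<le> x / real n" by (auto simp: pos_le_divide_eq)
        have "ln (x / real n) \<le> ln x" using n x by (simp add: ln_div)
        moreover have "0 \<le> ln (x / real n)" using n by simp
        ultimately show "M * (x / real n * (1 + ln (x / real n)) ^ m) \<le> M * (x / real n * (1 + ln x) ^ m)"
          using M n by (intro mult_left_mono power_mono) auto
      qed
      also have "\<dots> = M * (x * (1 + ln x) ^ m * sum_upto (\<lambda>n. 1 / real n) x)"
        by (simp add: sum_upto_def sum_distrib_left)
      also have "\<dots> \<le> M * (x * (1 + ln x) ^ m * (1 + ln x))"
        using M x harmonic by (intro mult_left_mono) auto
      finally show "sum_upto (\<lambda>n. M * (x / real n * (1 + ln (x / real n)) ^ m)) x \<le> M * (x * (1 + ln x) ^ Suc m)"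
        by (simp add: mult_ac)
    qed
    finally show "norm (sum_upto f x - ?C * of_real (x * ln x ^ Suc (Suc m) / fact (Suc (Suc m))))
        \<le> (norm ?C + M) * (x * (1 + ln x) ^ Suc m)"
      by (simp only: distrib_right)
  qed
qed

text \<open>Taking differences of coefficients multiplies a power series in \<open>1 / p\<close> by
  \<open>1 - 1 / p\<close>; the constant term 1 is unchanged.\<close>

lemma local_series_moebius_diff_sums:
  assumes f: "multiplicative_fun f" and p: "prime p" and s: "local_series f p sums s"
  shows "local_series (moebius_diff f) p sums ((1 - 1 / of_nat p) * s)"
proof -
  have p0: "p > 0" using p by (rule prime_gt_0_nat)
  have eq: "local_series (moebius_diff f) p (Suc \<alpha>) =
      local_series f p (Suc \<alpha>) - 1 / of_nat p * local_series f p \<alpha>" for \<alpha>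
    unfolding local_series_def moebius_diff_prime_power[OF p] using p0 by (simp add: field_simps)
  have "(\<lambda>\<alpha>. local_series f p (Suc \<alpha>)) sums (s - local_series f p 0)"
    using s by (simp add: sums_Suc_iff)
  then have "(\<lambda>\<alpha>. local_series (moebius_diff f) p (Suc \<alpha>)) sums
      (s - local_series f p 0 - 1 / of_nat p * s)"
    unfolding eq using s by (intro sums_diff sums_mult)
  moreover have "local_series (moebius_diff f) p 0 = local_series f p 0"
    using f multiplicative_moebius_diff[of f] by (simp add: local_series_def multiplicative_fun_1)
  ultimately show ?thesis by (simp add: sums_Suc_iff algebra_simps)
qed

lemma local_series_moebius_diff_power_sums:
  assumes f: "multiplicative_fun f" and p: "prime p" and s: "local_series f p sums s"
  shows "local_series ((moebius_diff ^^ j) f) p sums ((1 - 1 / of_nat p) ^ j * s)"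
proof (induction j)
  case (Suc j)
  then show ?case
    using local_series_moebius_diff_sums[OF multiplicative_moebius_diff_power[OF f] p Suc.IH]
    by (simp add: mult.assoc)
qed (use s in simp)

text \<open>Each step subtracts the value at 1, which is 1. With \<open>f p = k\<close> and
  \<open>j = k\<close> the result is 0.\<close>

lemma moebius_diff_power_prime:
  assumes f: "multiplicative_fun f" and p: "prime p"
  shows "(moebius_diff ^^ j) f p = f p - of_nat j"
proof (induction j)
  case (Suc j)
  then show ?case
    using moebius_diff_prime_power[OF p, of "(moebius_diff ^^ j) f" 0]
      multiplicative_moebius_diff_power[OF f, of j]
    by (simp add: multiplicative_fun_1)
qed simp

text \<open>The bound increases with the exponent, so each difference at most doubles it. The base
  \<open>\<alpha> + 1\<close> keeps the bound positive at exponent 0, where the value is 1.\<close>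

lemma norm_moebius_diff_power_le:
  assumes f: "multiplicative_fun f" and p: "prime p" and K: "K \<ge> 0" and B: "B \<ge> 1"
    and le: "\<And>\<alpha>. norm (f (p ^ \<alpha>)) \<le> B * (real \<alpha> + 1) powr K"
  shows "norm ((moebius_diff ^^ j) f (p ^ \<alpha>)) \<le> 2 ^ j * B * (real \<alpha> + 1) powr K"
proof (induction j arbitrary: \<alpha>)
  case (Suc j)
  show ?case
  proof (cases \<alpha>)
    case 0
    have "1 \<le> 2 ^ Suc j * B" using B mult_mono[of 1 "2 ^ Suc j" 1 B] by (simp del: power_Suc)
    then show ?thesis
      using 0 multiplicative_moebius_diff_power[OF f, of "Suc j"]
      by (simp add: multiplicative_fun_1 del: funpow.simps power_Suc)
  next
    case (Suc \<beta>)
    have step: "norm ((moebius_diff ^^ Suc j) f (p ^ Suc \<beta>)) \<le>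
        norm ((moebius_diff ^^ j) f (p ^ Suc \<beta>)) + norm ((moebius_diff ^^ j) f (p ^ \<beta>))"
      using norm_triangle_ineq4 by (simp add: moebius_diff_prime_power[OF p] del: power_Suc)
    have "2 ^ j * B * (real \<beta> + 1) powr K \<le> 2 ^ j * B * (real (Suc \<beta>) + 1) powr K"
      using B K by (intro mult_left_mono powr_mono2) auto
    then have "norm ((moebius_diff ^^ j) f (p ^ \<beta>)) \<le> 2 ^ j * B * (real (Suc \<beta>) + 1) powr K"
      using Suc.IH[of \<beta>] by linarith
    moreover have "norm ((moebius_diff ^^ j) f (p ^ Suc \<beta>)) \<le> 2 ^ j * B * (real (Suc \<beta>) + 1) powr K"
      by (rule Suc.IH)
    ultimately have "norm ((moebius_diff ^^ Suc j) f (p ^ Suc \<beta>)) \<le>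
        2 * (2 ^ j * B * (real (Suc \<beta>) + 1) powr K)"
      using step by linarith
    then show ?thesis by (simp only: Suc power_Suc mult.assoc)
  qed
qed (use le in simp)

section \<open>Convergence with weight \<open>n powr (-3/4)\<close> and the Euler product of the
  constant\<close>

lemma summable_powr_times_geometric:
  "summable (\<lambda>n. (real n + c) powr K * 2 powr (-3/4 * real n))"
proof (rule summable_comparison_test_bigo)
  show "summable (\<lambda>n. norm (real n powr (-2)))"
    by (simp add: summable_real_powr_iff)
  show "(\<lambda>n. (real n + c) powr K * 2 powr (-3/4 * real n)) \<in> O(\<lambda>n. real n powr (-2))"
    by real_asymp
qed

text \<open>Since \<open>g\<close> vanishes at primes, the weighted local sums are
  \<open>1 + O(p powr (-3/2))\<close>, and these errors are summable. Any weight exponent strictly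
  between 1/2 and 1 would serve: above 1/2 for this convergence, below 1 for the power
  saving.\<close>

lemma euler_product_vanishing_at_primes:
  fixes g :: "nat \<Rightarrow> complex"
  assumes g: "multiplicative_fun g" and gp: "\<And>p. prime p \<Longrightarrow> g p = 0" and B: "B \<ge> 0"
    and le: "\<And>p \<alpha>. prime p \<Longrightarrow> norm (g (p ^ \<alpha>)) \<le> B * (real \<alpha> + 1) powr K"
  shows "(\<lambda>n. norm (g n) * real n powr (-3/4)) summable_on {0<..}"
    and "\<And>p. prime p \<Longrightarrow> summable (local_series g p)"
    and "convergent_prod (\<lambda>p. if prime p then \<Sum>\<alpha>. local_series g p \<alpha> else 1)"
    and "(\<Prod>p. if prime p then \<Sum>\<alpha>. local_series g p \<alpha> else 1) = (\<Sum>\<^sub>\<infinity>n\<in>{0<..}. g n / of_nat n)"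
proof -
  define h where "h = (\<lambda>n. of_real (real n powr (-3/4)) * g n)"
  have norm_h: "norm (h n) = norm (g n) * real n powr (-3/4)" for n
    by (simp add: h_def norm_mult)
  have h: "multiplicative_fun h"
    using g unfolding multiplicative_fun_def h_def by (simp add: powr_mult)
  \<comment> \<open>The exponent is shifted by 2, whence \<open>\<alpha> + 3\<close>. The factor
    \<open>p powr (-3/2)\<close> is split off and the rest bounded by its value at
    \<open>p = 2\<close>, so \<open>w\<close> is independent of \<open>p\<close>.\<close>
  define w where "w = (\<lambda>\<alpha>. (real \<alpha> + 3) powr K * 2 powr (-3/4 * real \<alpha>))"
  have w: "summable w" unfolding w_def by (rule summable_powr_times_geometric)
  define c where "c = (\<lambda>n. B * suminf w * real n powr (-3/2))"
  have "suminf w \<ge> 0" using w by (intro suminf_nonneg) (auto simp: w_def)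
  then have c: "summable c" "\<And>n. c n \<ge> 0"
    using B by (auto simp: c_def summable_real_powr_iff intro!: summable_mult)
  have pw: "real (p ^ \<alpha>) powr (-3/4) = real p powr (-3/4 * real \<alpha>)" if "prime p" for p \<alpha>
    using prime_gt_0_nat[OF that] by (simp add: powr_realpow[symmetric] powr_powr mult.commute)
  have tail: "norm (h (p ^ (\<alpha> + 2))) \<le> B * real p powr (-3/2) * w \<alpha>" if p: "prime p" for p \<alpha>
  proof -
    have p2: "2 \<le> real p" using prime_ge_2_nat[OF p] by simp
    have "real p powr (-3/4 * real \<alpha>) \<le> 2 powr (-3/4 * real \<alpha>)"
      using p2 by (intro powr_mono2') auto
    then have "real p powr (-3/2) * real p powr (-3/4 * real \<alpha>) \<le> real p powr (-3/2) * 2 powr (-3/4 * real \<alpha>)"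
      by (intro mult_left_mono) auto
    moreover have "-3/4 * real (\<alpha> + 2) = -3/2 + -3/4 * real \<alpha>" by (simp add: field_simps)
    then have "real (p ^ (\<alpha> + 2)) powr (-3/4) = real p powr (-3/2) * real p powr (-3/4 * real \<alpha>)"
      unfolding pw[OF p] powr_add[symmetric] by (rule arg_cong)
    ultimately have "real (p ^ (\<alpha> + 2)) powr (-3/4) \<le> real p powr (-3/2) * 2 powr (-3/4 * real \<alpha>)"
      by simp
    moreover have "norm (g (p ^ (\<alpha> + 2))) \<le> B * (real \<alpha> + 3) powr K"
      using le[OF p, of "\<alpha> + 2"] by (simp add: add.commute)
    ultimately have "norm (h (p ^ (\<alpha> + 2))) \<le>
        (B * (real \<alpha> + 3) powr K) * (real p powr (-3/2) * 2 powr (-3/4 * real \<alpha>))"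
      unfolding norm_h using B by (intro mult_mono) auto
    then show ?thesis by (simp add: w_def mult_ac)
  qed
  have sm_tail: "summable (\<lambda>\<alpha>. norm (h (p ^ (\<alpha> + 2))))" if "prime p" for p
    by (rule summable_comparison_test'[OF summable_mult[OF w]]) (use tail[OF that] in simp)
  have sm: "summable (\<lambda>\<alpha>. norm (h (p ^ \<alpha>)))" if "prime p" for p
    using sm_tail[OF that] by (simp only: summable_iff_shift[of "\<lambda>\<alpha>. norm (h (p ^ \<alpha>))" 2])
  have tail_le: "(\<Sum>\<alpha>. norm (h (p ^ (\<alpha> + 2)))) \<le> c p" if p: "prime p" for p
  proof -
    have "(\<Sum>\<alpha>. norm (h (p ^ (\<alpha> + 2)))) \<le> (\<Sum>\<alpha>. B * real p powr (-3/2) * w \<alpha>)"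
      by (intro suminf_le tail[OF p] sm_tail[OF p] summable_mult[OF w])
    also have "\<dots> = c p" unfolding suminf_mult[OF w] c_def by (simp only: mult_ac)
    finally show ?thesis .
  qed
  have hp: "h (p ^ 0) = 1" "h (p ^ 1) = 0" if "prime p" for p
    using gp[OF that] multiplicative_fun_1[OF h] by (simp_all add: h_def)
  have sum_le: "(\<Sum>\<alpha>. norm (h (p ^ \<alpha>))) \<le> 1 + c p" if p: "prime p" for p
    using suminf_split_initial_segment[OF sm[OF p], of 2] tail_le[OF p] hp[OF p]
    by (simp add: numeral_2_eq_2)
  have abs_h: "(\<lambda>n. norm (h n)) summable_on {0<..}"
    by (rule multiplicative_abs_summable[OF h sm sum_le c])
  then show "(\<lambda>n. norm (g n) * real n powr (-3/4)) summable_on {0<..}"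
    by (simp add: norm_h)

  define q where "q = (\<lambda>n. g n / of_nat n)"
  have q_le: "norm (q n) \<le> norm (h n)" if "n > 0" for n
  proof -
    have "norm (g n) * real n powr (-1) \<le> norm (g n) * real n powr (-3/4)"
      using that by (intro mult_left_mono powr_mono) auto
    then show ?thesis using that by (simp add: norm_h q_def norm_divide powr_neg_one)
  qed
  have local: "local_series g p = (\<lambda>\<alpha>. q (p ^ \<alpha>))" for p
    by (simp add: local_series_def q_def fun_eq_iff)
  have pos: "p ^ \<alpha> > 0" if "prime p" for p \<alpha> :: nat using that by (simp add: prime_gt_0_nat)
  have sq: "summable (\<lambda>\<alpha>. norm (q (p ^ \<alpha>)))" if "prime p" for p
    by (rule summable_comparison_test'[OF sm[OF that]]) (use q_le[OF pos[OF that]] in simp)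
  show "summable (local_series g p)" if "prime p" for p
    unfolding local by (rule summable_norm_cancel[OF sq[OF that]])
  let ?E = "\<lambda>p. if prime p then \<Sum>\<alpha>. local_series g p \<alpha> else 1"
  \<comment> \<open>The terms at exponents 0 and 1 are 1 and 0, so only the tail from exponent 2
    remains. Summable deviations from 1 give convergence of the product even if some factors
    vanish.\<close>
  have E_le: "norm (?E p - 1) \<le> c p" for p
  proof (cases "prime p")
    case True
    have sq2: "summable (\<lambda>\<alpha>. norm (q (p ^ (\<alpha> + 2))))"
      using sq[OF True] by (simp only: summable_iff_shift[of "\<lambda>\<alpha>. norm (q (p ^ \<alpha>))" 2])
    have "?E p - 1 = (\<Sum>\<alpha>. q (p ^ (\<alpha> + 2)))"
      using suminf_split_initial_segment[OF summable_norm_cancel[OF sq[OF True]], of 2]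
        gp[OF True] multiplicative_fun_1[OF g] True
      by (simp add: local numeral_2_eq_2 q_def)
    also have "norm \<dots> \<le> (\<Sum>\<alpha>. norm (q (p ^ (\<alpha> + 2))))"
      by (rule summable_norm[OF sq2])
    also have "\<dots> \<le> (\<Sum>\<alpha>. norm (h (p ^ (\<alpha> + 2))))"
      by (intro suminf_le sq2 sm_tail True q_le pos)
    also have "\<dots> \<le> c p" by (rule tail_le[OF True])
    finally show ?thesis .
  qed (simp add: c)
  have "summable (\<lambda>p. norm (?E p - 1))"
    by (rule summable_comparison_test'[OF c(1)]) (use E_le in simp)
  then show conv: "convergent_prod ?E"
    by (intro abs_convergent_prod_imp_convergent_prod summable_imp_abs_convergent_prod)

  have q: "multiplicative_fun q"
    using g unfolding multiplicative_fun_def q_def by simp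
  have "(\<lambda>n. norm (q n)) summable_on {0<..}"
    by (rule Infinite_Sum.abs_summable_on_comparison_test'[OF abs_h]) (simp add: q_le)
  then have "(\<lambda>N. \<Prod>p\<le>N. ?E p) \<longlonglongrightarrow> infsum q {0<..}"
    unfolding local by (rule euler_product_LIMSEQ[OF q])
  \<comment> \<open>The same partial products converge to the infinite product and to the sum over
    all positive integers.\<close>
  with convergent_prod_LIMSEQ[OF conv] have "prodinf ?E = infsum q {0<..}"
    by (rule LIMSEQ_unique)
  then show "prodinf ?E = (\<Sum>\<^sub>\<infinity>n\<in>{0<..}. g n / of_nat n)"
    by (simp only: q_def)
qed

text \<open>As \<open>p \<ge> 2\<close>, the weight \<open>1 / p ^ \<alpha>\<close> is below the
  geometric term of ratio \<open>2 powr (-3/4)\<close>, whose product with a power of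
  \<open>\<alpha> + 1\<close> is already known to be summable.\<close>

lemma summable_local_series:
  assumes p: "prime p" and le: "\<And>\<alpha>. norm (f (p ^ \<alpha>)) \<le> B * (real \<alpha> + 1) powr K"
  shows "summable (local_series f p)"
proof (rule summable_comparison_test')
  show "summable (\<lambda>\<alpha>. B * ((real \<alpha> + 1) powr K * 2 powr (-3/4 * real \<alpha>)))"
    by (intro summable_mult summable_powr_times_geometric)
  fix \<alpha> :: nat
  have p2: "2 \<le> real p" using prime_ge_2_nat[OF p] by simp
  have "1 / real (p ^ \<alpha>) = real p powr (- real \<alpha>)"
    using p2 by (simp add: powr_minus_divide powr_realpow)
  also have "\<dots> \<le> 2 powr (- real \<alpha>)" using p2 by (intro powr_mono2') auto
  also have "\<dots> \<le> 2 powr (-3/4 * real \<alpha>)" by (intro powr_mono) auto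
  finally have "norm (f (p ^ \<alpha>)) * (1 / real (p ^ \<alpha>)) \<le>
      (B * (real \<alpha> + 1) powr K) * 2 powr (-3/4 * real \<alpha>)"
    using le[of \<alpha>] by (intro mult_mono order_trans[OF norm_ge_zero le]) auto
  then show "norm (local_series f p \<alpha>) \<le> B * ((real \<alpha> + 1) powr K * 2 powr (-3/4 * real \<alpha>))"
    by (simp add: local_series_def norm_divide norm_power mult_ac)
qed

section \<open>Identification of the constant, and the error term for \<open>k = 1\<close> and
  \<open>k \<ge> 2\<close>\<close>

theorem theorem1:
  fixes k :: nat and f :: "nat \<Rightarrow> complex" and K :: real
  assumes "k \<ge> 1"
    and "multiplicative_fun f"
    and "\<And>p. prime p \<Longrightarrow> f p = of_nat k"
    and "K > 0"
    and "\<And>p \<alpha>. prime p \<Longrightarrow> \<alpha> \<ge> 2 \<Longrightarrow> norm (f (p ^ \<alpha>)) \<le> real \<alpha> powr K"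
  shows "(\<forall>p. prime p \<longrightarrow> summable (local_series f p)) \<and>
         convergent_prod (local_factor k f) \<and>
         (\<exists>M. \<forall>x::real. x \<ge> 2 \<longrightarrow>
            norm ((\<Sum>n | 1 \<le> n \<and> real n \<le> x. f n)
                    - mean_const k f * of_real (x * ln x ^ (k - 1)))
              \<le> M * (x * ln x powi (int k - 2)))"
proof -
  note f = assms(2)
  \<comment> \<open>One bound for all exponents: the factor \<open>k\<close> covers exponent 1,
    where the value is \<open>k\<close>, and is at least 1 for the others.\<close>
  have f_le: "norm (f (p ^ \<alpha>)) \<le> real k * (real \<alpha> + 1) powr K" if p: "prime p" for p \<alpha>
  proof -
    have ge1: "1 \<le> (real \<alpha> + 1) powr K" using assms(4) by (intro ge_one_powr_ge_zero) auto
    have *: "1 * (real \<alpha> + 1) powr K \<le> real k * (real \<alpha> + 1) powr K"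
      using assms(1) by (intro mult_right_mono) auto
    consider "\<alpha> = 0" | "\<alpha> = 1" | "\<alpha> \<ge> 2" by linarith
    then show ?thesis
    proof cases
      case 1
      then show ?thesis using f assms(1) by (simp add: multiplicative_fun_1)
    next
      case 2
      then show ?thesis using assms(3)[OF p] mult_left_mono[OF ge1, of "real k"] by simp
    next
      case 3
      have "real \<alpha> powr K \<le> (real \<alpha> + 1) powr K" using assms(4) by (intro powr_mono2) auto
      then show ?thesis using assms(5)[OF p 3] * by linarith
    qed
  qed
  define g where "g = (moebius_diff ^^ k) f"
  have g: "multiplicative_fun g"
    unfolding g_def by (rule multiplicative_moebius_diff_power[OF f])
  have gp: "g p = 0" if "prime p" for p
    using moebius_diff_power_prime[OF f that, of k] assms(3)[OF that] by (simp add: g_def)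
  have g_le: "norm (g (p ^ \<alpha>)) \<le> 2 ^ k * real k * (real \<alpha> + 1) powr K" if "prime p" for p \<alpha>
    unfolding g_def using assms(1,4) f_le[OF that]
    by (intro norm_moebius_diff_power_le[OF f that]) auto
  have "(0::real) \<le> 2 ^ k * real k" by simp
  note E = euler_product_vanishing_at_primes[OF g gp this g_le]
  have sm: "summable (local_series f p)" if "prime p" for p
    by (rule summable_local_series[OF that f_le[OF that]])
  \<comment> \<open>The power \<open>(1 - 1 / p) ^ k\<close> is exactly what \<open>k\<close>
    Moebius differences contribute to the local series.\<close>
  have factor: "local_factor k f = (\<lambda>p. if prime p then \<Sum>\<alpha>. local_series g p \<alpha> else 1)"
  proof
    fix p
    show "local_factor k f p = (if prime p then \<Sum>\<alpha>. local_series g p \<alpha> else 1)"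
      using local_series_moebius_diff_power_sums[OF f _ summable_sums[OF sm], of p k]
      by (auto simp: local_factor_def g_def sums_iff)
  qed
  have conv: "convergent_prod (local_factor k f)"
    unfolding factor by (rule E(3))
  define C where "C = (\<Sum>\<^sub>\<infinity>n\<in>{0<..}. g n / of_nat n)"
  have "prodinf (local_factor k f) = C"
    unfolding factor C_def by (rule E(4))
  then have const: "mean_const k f = 1 / fact (k - 1) * C"
    by (simp add: mean_const_def)
  have "\<exists>M. \<forall>x\<ge>2. norm (sum_upto f x - mean_const k f * of_real (x * ln x ^ (k - 1)))
      \<le> M * (x * ln x powi (int k - 2))"
  \<comment> \<open>For \<open>k = 1\<close> the claimed error is \<open>x / ln x\<close>, and a
    single divisor sum with error \<open>x powr (3/4)\<close> suffices.\<close>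
  proof (cases "k = 1")
    case True
    have "g = moebius_diff f" using True by (simp add: g_def)
    then obtain M where M: "M \<ge> 0" and le:
      "\<And>x. x \<ge> 1 \<Longrightarrow> norm (sum_upto f x - C * of_real x) \<le> M * x powr (3/4)"
      using sum_upto_divisor_sum_linear[OF E(1)] sum_upto_moebius_diff[OF f] unfolding C_def by auto
    show ?thesis
    proof (intro exI[of _ "4 * M"] allI impI)
      fix x :: real assume x: "x \<ge> 2"
      \<comment> \<open>This converts the power saving into the bound
        \<open>x powr (3/4) \<le> 4 * (x / ln x)\<close>.\<close>
      have "ln x \<le> 4 * x powr (1/4)" using x ln_powr_bound[of x "1/4"] by simp
      then have "x powr (3/4) * ln x \<le> x powr (3/4) * (4 * x powr (1/4))"
        by (intro mult_left_mono) auto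
      also have "\<dots> = 4 * x" using x by (simp add: powr_add[symmetric])
      finally have "x powr (3/4) \<le> 4 * (x / ln x)" using x by (simp add: field_simps)
      then have "M * x powr (3/4) \<le> M * (4 * (x / ln x))" using M by (rule mult_left_mono)
      moreover have "x * ln x powi (int k - 2) = x / ln x"
        using True by (simp add: power_int_minus divide_inverse)
      ultimately show "norm (sum_upto f x - mean_const k f * of_real (x * ln x ^ (k - 1)))
          \<le> 4 * M * (x * ln x powi (int k - 2))"
        using le[of x] x True const by (simp add: mult_ac)
    qed
  next
    case False
    then obtain m where k: "k = Suc (Suc m)"
      using assms(1) by (metis One_nat_def not0_implies_Suc not_one_le_zero)
    obtain M where M: "M \<ge> 0" and le: "\<And>x. x \<ge> 1 \<Longrightarrow>
        norm (sum_upto f x - C * of_real (x * ln x ^ Suc m / fact (Suc m))) \<le> M * (x * (1 + ln x) ^ m)"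
      using sum_upto_asymptotics[OF f, of m] E(1) unfolding C_def g_def k by blast
    show ?thesis
    proof (intro exI[of _ "M * 3 ^ m"] allI impI)
      fix x :: real assume x: "x \<ge> 2"
      \<comment> \<open>For \<open>x \<ge> 2\<close> one has
        \<open>ln x \<ge> 1 - 1 / x \<ge> 1 / 2\<close>, hence
        \<open>1 + ln x \<le> 3 * ln x\<close>; this is the source of \<open>3 ^ m\<close>.\<close>
      have "1 / x \<le> 1 / 2" "ln (1 / x) = - ln x" "ln (1 / x) \<le> 1 / x - 1"
        using x ln_le_minus_one[of "1 / x"] by (simp_all add: ln_div)
      then have "1 \<le> 2 * ln x" by linarith
      then have "(1 + ln x) ^ m \<le> (3 * ln x) ^ m" using x by (intro power_mono) auto
      then have "M * (x * (1 + ln x) ^ m) \<le> M * (x * (3 * ln x) ^ m)"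
        using M x by (intro mult_left_mono) auto
      moreover have "ln x powi (int k - 2) = ln x ^ m"
        using k by (simp add: power_int_def)
      moreover have "mean_const k f * of_real (x * ln x ^ (k - 1)) = C * of_real (x * ln x ^ Suc m / fact (Suc m))"
        unfolding const by (simp add: k del: fact_Suc)
      ultimately show "norm (sum_upto f x - mean_const k f * of_real (x * ln x ^ (k - 1)))
          \<le> M * 3 ^ m * (x * ln x powi (int k - 2))"
        using le[of x] x by (simp add: power_mult_distrib mult_ac)
    qed
  qed
  with sm conv show ?thesis unfolding sum_upto_def by blast
qed

end
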